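(* Let $\rho$ be an $\mathbb{N}$-valued random variable, and consider the coverage model on $\mathbb{N}^d$ with parameter $p$ and radius distribution $\rho$, as defined in the context; write $\mathbb{P}_p$ for its law. (i) For $d=1$, let $$l := \liminf_{j \to \infty} j\, \mathbb{P}(\rho \geq j) > 1 \quad\text{and}\quad L:= \limsup_{j \to \infty} j\, \mathbb{P}(\rho \geq j) < \infty.$$ Then $$\mathbb{P}_p (\mathbb{N} \text{ is eventually doubly covered}) = \begin{cases} 1 & \text{if } p > 1/l,\\ 0 & \text{if } p < 1/L. \end{cases}$$ (ii) For $d\geq 2$ and $p>0$, $$\mathbb{P}_p (\mathbb{N}^d \text{ is eventually doubly covered}) = \begin{cases} 1 & \text{if } \liminf_{j \to \infty} j\, \mathbb{P}(\rho \geq j) > 0,\\ 0 & \text{if } \lim_{j \to \infty} j\, \mathbb{P}(\rho \geq j) =0. \end{cases}$$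
   Context: $\mathbb{N}=\{0,1,2,\dots\}$. Let $\{X_{\mathbf i}: \mathbf i \in \mathbb{N}^d\}$ be i.i.d. Bernoulli($p$) random variables ($X_{\mathbf i}=1$ with probability $p$ and $0$ with probability $1-p$), and let $\{\rho_{\mathbf i}: \mathbf i \in \mathbb{N}^d\}$ be i.i.d. $\mathbb{N}$-valued random variables with the same distribution as $\rho$, independent of $\{X_{\mathbf i}\}$. For $\mathbf i=(i_1,\dots,i_d)$ write $\mathbf i+[0,\rho_{\mathbf i}]^d = [i_1, i_1 + \rho_{\mathbf i}] \times \cdots \times [i_d, i_d + \rho_{\mathbf i}]$. Define $$\mathbf D := \{\mathbf x \in \mathbb{R}^d: \text{there exist } \mathbf i, \mathbf j\in \mathbb{N}^d \text{ with } \mathbf i \neq \mathbf j,\ X_{\mathbf i} = X_{\mathbf j} = 1 \text{ and } \mathbf x \in(\mathbf i + [0, \rho_{\mathbf i}]^d) \cap (\mathbf j+[0,\rho_{\mathbf j}]^d)\}.$$ $\mathbb{N}^d$ is said to be eventually doubly covered if there exists $\mathbf t \in \mathbb{N}^d$ such that $\mathbf t + \mathbb{N}^d \subseteq \mathbf D$.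
   Formalization: In the probability-0 case of (ii), the case p = 1 with ρ ≥ 1 almost surely is excluded; there every point of (1,…,1)+N^d is doubly covered almost surely, so the claim as stated fails (e.g. p = 1, ρ = 1). *)

theory Defs
  imports "HOL-Probability.Probability"
begin

definition real_vec :: "nat ^ 'd \<Rightarrow> real ^ 'd" where
  "real_vec i = (\<chi> k. real (i $ k))"

definition site_box :: "nat ^ 'd \<Rightarrow> nat \<Rightarrow> (real ^ 'd) set" where
  "site_box i r = cbox (real_vec i) (real_vec i + (\<chi> k. real r))"

(* x and r are one realisation of the fields (X_i) and (rho_i). *)
definition doubly_covered_set ::
    "(nat ^ 'd \<Rightarrow> nat) \<Rightarrow> (nat ^ 'd \<Rightarrow> nat) \<Rightarrow> (real ^ 'd) set" where
  "doubly_covered_set x r =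
     {y. \<exists>i j. i \<noteq> j \<and> x i = 1 \<and> x j = 1 \<and> y \<in> site_box i (r i) \<inter> site_box j (r j)}"

definition eventually_doubly_covered ::
    "(nat ^ 'd \<Rightarrow> nat) \<Rightarrow> (nat ^ 'd \<Rightarrow> nat) \<Rightarrow> bool" where
  "eventually_doubly_covered x r \<longleftrightarrow>
     (\<exists>t. (\<lambda>n. real_vec (t + n)) ` UNIV \<subseteq> doubly_covered_set x r)"

(* rho may live on a probability space N different from M; only its distribution enters. *)
locale coverage_model = prob_space M
  for M :: "'a measure"
    and p :: real
    and N :: "'b measure"
    and rho :: "'b \<Rightarrow> nat"
    and X :: "nat ^ 'd \<Rightarrow> 'a \<Rightarrow> nat"
    and R :: "nat ^ 'd \<Rightarrow> 'a \<Rightarrow> nat" +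
  assumes p_range: "0 \<le> p" "p \<le> 1"
    and prob_space_N: "prob_space N"
    and rho_measurable: "rho \<in> measurable N (count_space UNIV)"
    and X_indep: "indep_vars (\<lambda>_. count_space UNIV) X UNIV"
    and X_one: "\<And>i. \<P>(\<omega> in M. X i \<omega> = 1) = p"
    and X_zero: "\<And>i. \<P>(\<omega> in M. X i \<omega> = 0) = 1 - p"
    and R_indep: "indep_vars (\<lambda>_. count_space UNIV) R UNIV"
    and R_distr: "\<And>i. distr M (count_space UNIV) (R i) = distr N (count_space UNIV) rho"
    and X_R_indep:
      "indep_var (Pi\<^sub>M UNIV (\<lambda>_. count_space UNIV)) (\<lambda>\<omega> i. X i \<omega>)
                 (Pi\<^sub>M UNIV (\<lambda>_. count_space UNIV)) (\<lambda>\<omega> i. R i \<omega>)"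
begin

lemma X_measurable [measurable]: "X i \<in> measurable M (count_space UNIV)"
  using X_indep unfolding indep_vars_def by auto

lemma R_measurable [measurable]: "R i \<in> measurable M (count_space UNIV)"
  using R_indep unfolding indep_vars_def by auto

lemma eventually_doubly_covered_event:
  "{\<omega> \<in> space M. eventually_doubly_covered (\<lambda>i. X i \<omega>) (\<lambda>i. R i \<omega>)} \<in> sets M"
proof -
  have box: "{\<omega> \<in> space M. y \<in> site_box i (R i \<omega>)} \<in> sets M" for y and i :: "nat ^ 'd"
    by measurable
  show ?thesis
    unfolding eventually_doubly_covered_def doubly_covered_set_def image_subset_iff
      mem_Collect_eq Int_iff
    using box by measurable
qed

end

end

theory Submission
  imports Defs
begin

text \<open>
  Put \<open>q k = p * P(rho \<ge> k)\<close>, the probability that a given site covers a point at sup-distance \<open>k\<close> from it.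

  Coverage: the number of covers of \<open>n\<close> dominates a sum of independent indicators, so Markov's
  inequality for \<open>\<theta> ^ (number of covers)\<close> bounds the probability of at most one cover by
  \<open>exp (- (1 - \<theta>) * \<Sum>q) / \<theta>\<close>. If \<open>m\<close> is the largest coordinate of \<open>n\<close>, using \<open>w\<close> parallel rows of
  sites in that direction (\<open>w = 1\<close> in dimension one, \<open>w\<close> arbitrary otherwise, as soon as all coordinates
  of \<open>n\<close> are at least \<open>w\<close>) makes this at most a constant times \<open>(m + 1) powr - ((1 - \<theta>) * w * c)\<close>,
  and Borel-Cantelli over \<open>m\<close> applies.

  Non-coverage: fix a line parallel to an axis \<open>a\<close>. Only the finitely many lines of sites below it
  matter, and grouping these sites by their \<open>a\<close>-coordinate turns the problem into a one-dimensional
  one. There the points missed by all sites other than possibly themselves, themselves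
  having radius 0 if they are open, form a renewal process: once the point \<open>n\<close> is missed, the sites up
  to \<open>n\<close> play no role after \<open>n\<close>. Its renewal probabilities are bounded below by a multiple of
  \<open>1 / n\<close>, hence not summable. Since the events "\<open>n\<close> is the last renewal" are disjoint and have
  probability proportional to the renewal probability of \<open>n\<close>, they are null events, and there are
  infinitely many renewals. Tolerating a cover of a point by itself is what makes the argument
  work for \<open>p = 1\<close>.
\<close>

section \<open>Independent families\<close>

context prob_space
begin

lemma prob_all_in_eq_prod:
  assumes "indep_vars (\<lambda>_. count_space UNIV) Z I" "finite J" "J \<subseteq> I"
  shows "prob {\<omega> \<in> space M. \<forall>i\<in>J. Z i \<omega> \<in> A i} = (\<Prod>i\<in>J. prob {\<omega> \<in> space M. Z i \<omega> \<in> A i})"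
proof (cases "J = {}")
  case True
  then show ?thesis by (simp add: prob_space)
next
  case False
  have "prob (\<Inter>i\<in>J. Z i -` A i \<inter> space M) = (\<Prod>i\<in>J. prob (Z i -` A i \<inter> space M))"
    using assms False by (intro indep_varsD) auto
  moreover have "(\<Inter>i\<in>J. Z i -` A i \<inter> space M) = {\<omega> \<in> space M. \<forall>i\<in>J. Z i \<omega> \<in> A i}"
    using False by auto
  moreover have "Z i -` A i \<inter> space M = {\<omega> \<in> space M. Z i \<omega> \<in> A i}" for i
    by auto
  ultimately show ?thesis by simp
qed

text \<open>Injectivity makes the singleton blocks \<open>{f j}\<close> disjoint, so this is
  independence of blocks. It serves to shift the family in the renewal argument.\<close>

lemma indep_vars_reindex:
  assumes ind: "indep_vars M' Z I" and f: "inj_on f J" "f ` J \<subseteq> I"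
  shows "indep_vars (\<lambda>j. M' (f j)) (\<lambda>j. Z (f j)) J"
proof -
  have "indep_vars (\<lambda>j. Pi\<^sub>M {f j} M') (\<lambda>j \<omega>. restrict (\<lambda>i. Z i \<omega>) {f j}) J"
    using f by (intro indep_vars_restrict[OF ind]) (auto simp: disjoint_family_on_def inj_on_def)
  then have "indep_vars (\<lambda>j. M' (f j)) (\<lambda>j \<omega>. (restrict (\<lambda>i. Z i \<omega>) {f j}) (f j)) J"
    by (rule indep_vars_compose2) auto
  then show ?thesis by simp
qed

text \<open>Give \<open>x\<close> the weight \<theta> if \<open>Z x\<close> lies in
  \<open>A x\<close> and 1 otherwise. On the event the product of the weights is at least \<theta>;
  by independence its expectation is a product of factors
  \<open>1 - (1 - \<theta>) * prob ...\<close>. A free \<theta> lets the rate come arbitrarily close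
  to 1, at the price of the constant \<open>1 / \<theta>\<close>.\<close>

lemma prob_at_most_one_le:
  fixes \<theta> :: real
  assumes ind: "indep_vars (\<lambda>_. count_space UNIV) Z S" and "finite S" and \<theta>: "0 < \<theta>" "\<theta> < 1"
  shows "prob {\<omega> \<in> space M. \<forall>x\<in>S. \<forall>y\<in>S. Z x \<omega> \<in> A x \<longrightarrow> Z y \<omega> \<in> A y \<longrightarrow> x = y}
    \<le> exp (- (1 - \<theta>) * (\<Sum>x\<in>S. prob {\<omega> \<in> space M. Z x \<omega> \<in> A x})) / \<theta>"
    (is "prob ?E \<le> _")
proof -
  define f where "f x \<omega> = (if Z x \<omega> \<in> A x then \<theta> else 1)" for x \<omega>
  have meas: "Z x \<in> measurable M (count_space UNIV)" if "x \<in> S" for x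
    using ind that by (auto simp: indep_vars_def)
  have fm: "f x \<in> borel_measurable M" if "x \<in> S" for x
    unfolding f_def by (rule measurable_compose[OF meas[OF that]]) simp
  have f_bound: "0 \<le> f x \<omega>" "f x \<omega> \<le> 1" for x \<omega>
    using \<theta> by (auto simp: f_def)
  have int_f: "integrable M (f x)" if "x \<in> S" for x
    using f_bound by (intro integrable_const_bound[where B = 1] fm that) auto
  have prod_le: "indicator ?E \<omega> \<le> (\<Prod>x\<in>S. f x \<omega>) / \<theta>" for \<omega>
  proof (cases "\<omega> \<in> ?E")
    case True
    have "\<theta> \<le> (\<Prod>x\<in>S. f x \<omega>)"
    proof (cases "\<exists>x\<in>S. Z x \<omega> \<in> A x")
      case True
      then obtain x where x: "x \<in> S" "Z x \<omega> \<in> A x" by auto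
      have "(\<Prod>y\<in>S. f y \<omega>) = f x \<omega> * (\<Prod>y\<in>S - {x}. f y \<omega>)"
        using x \<open>finite S\<close> by (simp add: prod.remove)
      also have "(\<Prod>y\<in>S - {x}. f y \<omega>) = 1"
        using \<open>\<omega> \<in> ?E\<close> x by (intro prod.neutral) (auto simp: f_def)
      finally show ?thesis using x by (simp add: f_def)
    next
      case False
      then have "(\<Prod>y\<in>S. f y \<omega>) = 1" by (intro prod.neutral) (auto simp: f_def)
      then show ?thesis using \<theta> by simp
    qed
    then show ?thesis using True \<theta> by (simp add: field_simps)
  next
    case False
    then show ?thesis using \<theta> f_bound by (simp add: prod_nonneg)
  qed
  have indf: "indep_vars (\<lambda>_. borel) f S"
    unfolding f_def using indep_vars_compose2[OF ind, of "\<lambda>x z. if z \<in> A x then \<theta> else 1" "\<lambda>_. borel"]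
    by simp
  have Em: "?E \<in> events"
  proof -
    have [measurable]: "Measurable.pred M (\<lambda>\<omega>. Z x \<omega> \<in> A x)" if "x \<in> S" for x
      by (rule measurable_compose[OF meas[OF that]]) simp
    show ?thesis using \<open>finite S\<close> by measurable
  qed
  have prm: "(\<lambda>\<omega>. \<Prod>x\<in>S. f x \<omega>) \<in> borel_measurable M"
    using fm by measurable
  have int_prod: "integrable M (\<lambda>\<omega>. \<Prod>x\<in>S. f x \<omega>)"
    using indep_vars_integrable[OF \<open>finite S\<close> indf] int_f by simp
  have "prob ?E = (\<integral>\<omega>. indicator ?E \<omega> \<partial>M)"
    using Em by simp
  also have "\<dots> \<le> (\<integral>\<omega>. (\<Prod>x\<in>S. f x \<omega>) / \<theta> \<partial>M)"
    using Em int_prod by (intro integral_mono prod_le integrable_real_indicator) (auto simp: emeasure_eq_measure)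
  also have "\<dots> = (\<Prod>x\<in>S. expectation (f x)) / \<theta>"
    using indep_vars_lebesgue_integral[OF \<open>finite S\<close> indf] int_f by simp
  also have "(\<Prod>x\<in>S. expectation (f x)) \<le> (\<Prod>x\<in>S. exp (- (1 - \<theta>) * prob {\<omega> \<in> space M. Z x \<omega> \<in> A x}))"
  proof (intro prod_mono conjI)
    fix x assume x: "x \<in> S"
    show "0 \<le> expectation (f x)" using f_bound by simp
    have m: "{\<omega> \<in> space M. Z x \<omega> \<in> A x} \<in> events"
      using measurable_sets[OF meas[OF x], of "A x"] by (simp add: vimage_def Int_def conj_commute)
    have "expectation (f x) = (\<integral>\<omega>. 1 - (1 - \<theta>) * indicator {\<omega> \<in> space M. Z x \<omega> \<in> A x} \<omega> \<partial>M)"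
      by (intro Bochner_Integration.integral_cong) (auto simp: f_def)
    also have "\<dots> = 1 - (1 - \<theta>) * prob {\<omega> \<in> space M. Z x \<omega> \<in> A x}"
      using m by (subst Bochner_Integration.integral_diff)
        (auto simp: prob_space emeasure_eq_measure intro!: integrable_real_indicator)
    also have "\<dots> \<le> exp (- (1 - \<theta>) * prob {\<omega> \<in> space M. Z x \<omega> \<in> A x})"
      using exp_ge_add_one_self[of "- (1 - \<theta>) * prob {\<omega> \<in> space M. Z x \<omega> \<in> A x}"] by linarith
    finally show "expectation (f x) \<le> exp (- (1 - \<theta>) * prob {\<omega> \<in> space M. Z x \<omega> \<in> A x})" .
  qed
  also have "\<dots> = exp (- (1 - \<theta>) * (\<Sum>x\<in>S. prob {\<omega> \<in> space M. Z x \<omega> \<in> A x}))"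
    using \<open>finite S\<close> by (simp add: exp_sum sum_distrib_left)
  finally show ?thesis using \<theta> by (simp add: divide_right_mono)
qed

text \<open>Read \<open>Z c\<close> as the reach of position \<open>c\<close>; \<open>m\<close> is a
  renewal if no \<open>c \<le> m\<close> has \<open>Z c\<close> above \<open>max 1 (m - c)\<close>.
  In the proof \<open>V m\<close> is this event, and \<open>H n\<close> says that the process
  restarted at \<open>n\<close> has no renewal at all.\<close>

lemma AE_infinitely_many_renewals:
  fixes Z :: "nat \<Rightarrow> 'a \<Rightarrow> nat"
  assumes ind: "indep_vars (\<lambda>_. count_space UNIV) Z UNIV"
    and F: "\<And>c k. prob {\<omega> \<in> space M. Z c \<omega> \<le> k} = F k"
    and F1: "F 1 > 0"
    and tail: "eventually (\<lambda>k. 1 - 1 / real k \<le> F k) sequentially"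
  shows "AE \<omega> in M. \<exists>\<^sub>\<infinity>m. \<forall>c\<le>m. Z c \<omega> \<le> max 1 (m - c)"
proof -
  have Zm [measurable]: "Z c \<in> measurable M (count_space UNIV)" for c
    using ind by (auto simp: indep_vars_def)
  define V where "V m = {\<omega> \<in> space M. \<forall>c\<le>m. Z c \<omega> \<le> max 1 (m - c)}" for m
  define H where "H n = {\<omega> \<in> space M. \<forall>m. \<exists>c\<le>m. max 1 (m - c) < Z (n + c) \<omega>}" for n
  have [measurable]: "V m \<in> events" "H m \<in> events" for m
    unfolding V_def H_def by measurable
  have probV: "prob (V m) = (\<Prod>k\<le>m. F (max 1 k))" for m
  proof -
    have "prob (V m) = prob {\<omega> \<in> space M. \<forall>c\<in>{..m}. Z c \<omega> \<in> {..max 1 (m - c)}}"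
      by (simp add: V_def Ball_def)
    also have "\<dots> = (\<Prod>c\<le>m. F (max 1 (m - c)))"
      using ind by (subst prob_all_in_eq_prod) (auto simp: F)
    also have "\<dots> = (\<Prod>k\<le>m. F (max 1 k))"
      by (rule prod.reindex_bij_witness[of _ "\<lambda>k. m - k" "\<lambda>k. m - k"]) auto
    finally show ?thesis .
  qed
  have F_mono: "F j \<le> F k" if "j \<le> k" for j k
    unfolding F[of 0, symmetric] using that by (intro finite_measure_mono) auto
  have pos: "prob (V m) > 0" for m
    unfolding probV using F1 F_mono[of 1] by (intro prod_pos) (auto simp: less_le_trans)
  have not_summable: "\<not> summable (\<lambda>m. prob (V m))"
  proof
    assume sm: "summable (\<lambda>m. prob (V m))"
    obtain K0 where K0: "\<And>k. k \<ge> K0 \<Longrightarrow> 1 - 1 / real k \<le> F k"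
      using tail by (auto simp: eventually_sequentially)
    define K where "K = max K0 1"
    define C where "C = real K * prob (V K)"
    have C: "C > 0" using pos[of K] by (simp add: C_def K_def)
    \<comment> \<open>The factors \<open>1 - 1 / (n + 1) = n / (n + 1)\<close> telescope, so from
      \<open>K\<close> on \<open>prob (V n)\<close> decays no faster than
      \<open>C / n\<close>.\<close>
    have lower: "C / real n \<le> prob (V n)" if "n \<ge> K" for n
      using that
    proof (induction n rule: dec_induct)
      case base
      then show ?case by (simp add: C_def K_def)
    next
      case (step n)
      have n: "n \<ge> 1" using step by (simp add: K_def)
      have "C / real (Suc n) = C / real n * (1 - 1 / real (Suc n))"
        using n by (simp add: field_simps)
      also have "\<dots> \<le> prob (V n) * F (Suc n)"
        using step K0[of "Suc n"] C by (intro mult_mono) (auto simp: K_def)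
      also have "\<dots> = prob (V (Suc n))"
        by (simp add: probV)
      finally show ?case .
    qed
    have "summable (\<lambda>n. C / real n)"
      using C lower by (intro summable_comparison_test'[OF sm, of K]) auto
    then have "summable (\<lambda>n. C * (1 / real n))" by simp
    then have "summable (\<lambda>n. 1 / real n)"
      using C by (subst (asm) summable_cmult_iff) auto
    then show False
      using not_summable_harmonic[where 'a = real] by (simp add: inverse_eq_divide)
  qed
  \<comment> \<open>\<open>F\<close> determines the law of every \<open>Z c\<close>, so all shifted
    sequences have the same product law, and \<open>H n\<close> is one fixed event read off the
    sequence shifted by \<open>n\<close>.\<close>
  have probH: "prob (H n) = prob (H 0)" for n
  proof -
    let ?P = "Pi\<^sub>M UNIV (\<lambda>_::nat. count_space (UNIV :: nat set))"
    have distr_Z: "distr M (count_space UNIV) (Z c) = distr M (count_space UNIV) (Z 0)" for c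
    proof (rule measure_eqI_countable[where A = UNIV])
      fix k
      have "prob {\<omega> \<in> space M. Z c \<omega> = k} = F k - (if k = 0 then 0 else F (k - 1))" for c
      proof (cases k)
        case 0
        then show ?thesis using F[of c 0] by simp
      next
        case (Suc j)
        have "prob {\<omega> \<in> space M. Z c \<omega> = k}
            = prob ({\<omega> \<in> space M. Z c \<omega> \<le> k} - {\<omega> \<in> space M. Z c \<omega> \<le> j})"
          using Suc by (intro arg_cong[where f = prob]) auto
        also have "\<dots> = F k - F j"
          using Suc by (subst finite_measure_Diff) (auto simp: F)
        finally show ?thesis using Suc by simp
      qed
      then have "prob (Z c -` {k} \<inter> space M) = prob (Z 0 -` {k} \<inter> space M)"
        by (simp add: vimage_def Int_def conj_commute)
      then show "emeasure (distr M (count_space UNIV) (Z c)) {k} = emeasure (distr M (count_space UNIV) (Z 0)) {k}"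
        by (simp add: emeasure_distr emeasure_eq_measure)
    qed auto
    have law: "distr M ?P (\<lambda>\<omega> i. Z (n + i) \<omega>) = Pi\<^sub>M UNIV (\<lambda>_. distr M (count_space UNIV) (Z 0))" for n
    proof -
      have "indep_vars (\<lambda>_. count_space UNIV) (\<lambda>i. Z (n + i)) UNIV"
        by (rule indep_vars_reindex[OF ind]) auto
      then have "distr M ?P (\<lambda>\<omega>. \<lambda>i\<in>UNIV. Z (n + i) \<omega>)
          = Pi\<^sub>M UNIV (\<lambda>i. distr M (count_space UNIV) (Z (n + i)))"
        by (subst (asm) indep_vars_iff_distr_eq_PiM) auto
      also have "\<dots> = Pi\<^sub>M UNIV (\<lambda>_. distr M (count_space UNIV) (Z 0))"
        by (intro PiM_cong distr_Z) auto
      finally show ?thesis by (simp add: restrict_def)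
    qed
    define G where "G = {z \<in> space ?P. \<forall>m. \<exists>c\<le>m. max 1 (m - c) < z c}"
    have G: "G \<in> sets ?P" unfolding G_def by measurable
    have "prob (H n) = measure (distr M ?P (\<lambda>\<omega> i. Z (n + i) \<omega>)) G" for n
    proof -
      have "H n = (\<lambda>\<omega> i. Z (n + i) \<omega>) -` G \<inter> space M"
        by (auto simp: H_def G_def space_PiM)
      moreover have "(\<lambda>\<omega> i. Z (n + i) \<omega>) \<in> measurable M ?P"
        by (intro measurable_PiM_single') auto
      ultimately show ?thesis using G by (simp add: measure_distr)
    qed
    then show ?thesis by (simp add: law)
  qed
  \<comment> \<open>\<open>V n\<close> looks only at positions up to \<open>n\<close>,
    \<open>H (Suc n)\<close> only at later ones.\<close>
  have indepVH: "prob (V n \<inter> H (Suc n)) = prob (V n) * prob (H 0)" for n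
  proof -
    let ?A = "{..n}" and ?B = "{Suc n..}"
    let ?PA = "Pi\<^sub>M ?A (\<lambda>_::nat. count_space (UNIV :: nat set))"
    let ?PB = "Pi\<^sub>M ?B (\<lambda>_::nat. count_space (UNIV :: nat set))"
    let ?fA = "\<lambda>\<omega>. restrict (\<lambda>i. Z i \<omega>) ?A" and ?fB = "\<lambda>\<omega>. restrict (\<lambda>i. Z i \<omega>) ?B"
    define A where "A = {z \<in> space ?PA. \<forall>c\<in>?A. z c \<le> max 1 (n - c)}"
    define B where "B = {z \<in> space ?PB. \<forall>m. \<exists>c\<in>{..m}. max 1 (m - c) < z (Suc n + c)}"
    have iv: "indep_var ?PA ?fA ?PB ?fB"
      using ind by (intro indep_var_restrict) auto
    have "(\<lambda>z. z i) \<in> measurable ?PA (count_space UNIV)" if "i \<in> ?A" for i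
      using that by (intro measurable_component_singleton)
    then have A: "A \<in> sets ?PA"
      unfolding A_def by (intro sets.sets_Collect_finite_All' sets.sets_Collect) measurable
    have "(\<lambda>z. z (Suc n + i)) \<in> measurable ?PB (count_space UNIV)" for i
      by (intro measurable_component_singleton) auto
    then have B: "B \<in> sets ?PB"
      unfolding B_def by measurable
    have "prob ((\<lambda>x. (?fA x, ?fB x)) -` (A \<times> B) \<inter> space M)
        = prob (?fA -` A \<inter> space M) * prob (?fB -` B \<inter> space M)"
      using A B by (intro indep_varD[OF iv]) auto
    also have "?fA -` A \<inter> space M = V n"
      by (auto simp: A_def V_def space_PiM)
    also have "?fB -` B \<inter> space M = H (Suc n)"
      by (auto simp: B_def H_def space_PiM)
    also have "(\<lambda>x. (?fA x, ?fB x)) -` (A \<times> B) \<inter> space M = V n \<inter> H (Suc n)"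
      using \<open>?fA -` A \<inter> space M = V n\<close> \<open>?fB -` B \<inter> space M = H (Suc n)\<close> by blast
    finally show ?thesis by (simp add: probH[of "Suc n"])
  qed
  \<comment> \<open>\<open>V n \<inter> H (Suc n)\<close> says that \<open>n\<close> is the last
    renewal: a renewal \<open>m > n\<close> remains one when the positions up to \<open>n\<close>
    are dropped.\<close>
  have "disjoint_family (\<lambda>n. V n \<inter> H (Suc n))"
  proof -
    have "False" if "\<omega> \<in> H (Suc n)" "\<omega> \<in> V m" "n < m" for \<omega> n m
    proof -
      have "\<forall>k. \<exists>c\<le>k. max 1 (k - c) < Z (Suc n + c) \<omega>"
        using that(1) by (simp add: H_def)
      from this[THEN spec, of "m - Suc n"]
      obtain c where c: "c \<le> m - Suc n" "max 1 (m - Suc n - c) < Z (Suc n + c) \<omega>"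
        by (elim exE conjE)
      have "Suc n + c \<le> m" using c(1) that(3) by simp
      then have "Z (Suc n + c) \<omega> \<le> max 1 (m - (Suc n + c))"
        using that(2) by (simp add: V_def del: max_less_iff_conj max.bounded_iff)
      then show False using c(2) by (auto simp: max_def split: if_splits)
    qed
    then show ?thesis
      unfolding disjoint_family_on_def disjoint_iff Int_iff by (meson linorder_neqE_nat)
  qed
  then have "(\<lambda>n. prob (V n \<inter> H (Suc n))) sums prob (\<Union>n. V n \<inter> H (Suc n))"
    by (intro finite_measure_UNION) auto
  \<comment> \<open>The disjoint events have summable probabilities
    \<open>prob (V n) * prob (H 0)\<close>, while the \<open>prob (V n)\<close> alone are not
    summable; hence \<open>prob (H 0) = 0\<close>.\<close>
  then have "summable (\<lambda>n. prob (H 0) * prob (V n))"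
    by (simp add: indepVH sums_iff mult.commute)
  then have H0: "prob (H 0) = 0"
    using not_summable by (simp add: summable_cmult_iff)
  then have "AE \<omega> in M. \<forall>n. \<omega> \<notin> V n \<inter> H (Suc n)"
    by (intro AE_all_countable[THEN iffD2] allI AE_not_in)
      (auto simp: null_sets_def emeasure_eq_measure indepVH)
  moreover have "AE \<omega> in M. \<omega> \<notin> H 0"
    using H0 by (intro AE_not_in) (auto simp: null_sets_def emeasure_eq_measure)
  ultimately show ?thesis
    using AE_space
  proof eventually_elim
    case (elim \<omega>)
    show ?case
    proof (rule ccontr)
      assume "\<not> ?thesis"
      then have fin: "finite {m. \<omega> \<in> V m}"
        using elim by (simp add: V_def INFM_iff_infinite)
      show False
      proof (cases "{m. \<omega> \<in> V m} = {}")
        case True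
        then have "\<omega> \<in> H 0"
          using elim by (auto simp: H_def V_def not_le)
        then show False using elim by simp
      next
        case False
        define n where "n = Max {m. \<omega> \<in> V m}"
        have n: "\<omega> \<in> V n" using Max_in[OF fin False] by (simp add: n_def)
        have "\<exists>c\<le>m. max 1 (m - c) < Z (Suc n + c) \<omega>" for m
        proof -
          have "\<omega> \<notin> V (Suc n + m)"
            using Max_ge[OF fin, of "Suc n + m"] by (auto simp: n_def)
          then have "\<exists>c\<le>Suc n + m. max 1 (Suc n + m - c) < Z c \<omega>"
            using elim by (simp add: V_def not_le)
          then obtain c where c: "c \<le> Suc n + m" "max 1 (Suc n + m - c) < Z c \<omega>"
            by (elim exE conjE)
          \<comment> \<open>Renewal property: since \<open>n\<close> is a renewal, positions up to
            \<open>n\<close> obstruct no later time, so the obstruction at \<open>Suc n + m\<close>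
            comes from beyond \<open>n\<close>.\<close>
          have "\<not> c \<le> n"
          proof
            assume "c \<le> n"
            then have "Z c \<omega> \<le> max 1 (n - c)" using n by (simp add: V_def)
            then show False using c(2) by (auto simp: max_def split: if_splits)
          qed
          then have "c - Suc n \<le> m" "Suc n + (c - Suc n) = c" "Suc n + m - c = m - (c - Suc n)"
            using c(1) by auto
          then show ?thesis using c(2) by metis
        qed
        then have "\<omega> \<in> H (Suc n)" using elim by (simp add: H_def)
        then show False using elim n by simp
      qed
    qed
  qed
qed

end

section \<open>Lattice geometry\<close>

lemma real_vec_in_site_box_iff:
  "real_vec n \<in> site_box i r \<longleftrightarrow> (\<forall>k. i $ k \<le> n $ k \<and> n $ k \<le> i $ k + r)"
proof -
  have "real (n $ k) \<le> real (i $ k) + real r \<longleftrightarrow> n $ k \<le> i $ k + r" for k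
    by linarith
  then show ?thesis by (simp add: site_box_def real_vec_def mem_box_cart)
qed

lemma eventually_doubly_covered_iff:
  "eventually_doubly_covered x r \<longleftrightarrow>
    (\<exists>t. \<forall>n. (\<forall>k. t $ k \<le> n $ k) \<longrightarrow> real_vec n \<in> doubly_covered_set x r)"
proof -
  have "(\<forall>n. real_vec (t + n) \<in> doubly_covered_set x r)
      \<longleftrightarrow> (\<forall>n. (\<forall>k. t $ k \<le> n $ k) \<longrightarrow> real_vec n \<in> doubly_covered_set x r)" (is "?L \<longleftrightarrow> ?R") for t
  proof
    assume L: ?L
    show ?R
    proof (intro allI impI)
      fix n :: "nat ^ 'a" assume "\<forall>k. t $ k \<le> n $ k"
      then have "n = t + (\<chi> k. n $ k - t $ k)" by (simp add: vec_eq_iff)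
      then show "real_vec n \<in> doubly_covered_set x r" using L by metis
    qed
  qed simp
  then show ?thesis by (auto simp: eventually_doubly_covered_def image_subset_iff)
qed

text \<open>The shells of constant sup-norm, along which Borel-Cantelli is run.\<close>

definition sphere_sites :: "nat \<Rightarrow> (nat ^ 'd::finite) set" where
  "sphere_sites m = {n. (\<forall>k. n $ k \<le> m) \<and> (\<exists>k. n $ k = m)}"

lemma
  shows finite_sphere_sites: "finite (sphere_sites m :: (nat ^ 'd::finite) set)"
    and card_sphere_sites_le: "card (sphere_sites m :: (nat ^ 'd) set) \<le> (m + 1) ^ CARD('d)"
proof -
  have sub: "vec_nth ` (sphere_sites m :: (nat ^ 'd) set) \<subseteq> (\<Pi>\<^sub>E k\<in>UNIV. {..m})"
    by (auto simp: sphere_sites_def)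
  have inj: "inj_on vec_nth (sphere_sites m :: (nat ^ 'd) set)"
    by (auto simp: inj_on_def vec_nth_inject)
  have fin: "finite (\<Pi>\<^sub>E k\<in>(UNIV :: 'd set). {..m})"
    by (intro finite_PiE) auto
  show "finite (sphere_sites m :: (nat ^ 'd) set)"
    using finite_subset[OF sub fin] inj by (rule finite_imageD)
  have "card (sphere_sites m :: (nat ^ 'd) set) = card (vec_nth ` (sphere_sites m :: (nat ^ 'd) set))"
    using inj by (simp add: card_image)
  also have "\<dots> \<le> card (\<Pi>\<^sub>E k\<in>(UNIV :: 'd set). {..m})"
    using sub fin by (rule card_mono[rotated])
  finally show "card (sphere_sites m :: (nat ^ 'd) set) \<le> (m + 1) ^ CARD('d)"
    by (simp add: card_PiE)
qed

text \<open>The general bound \<open>m + 1\<close> would spoil the threshold \<open>1 / l\<close> in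
  dimension one; there a shell is a single point.\<close>

lemma card_sphere_sites_dim_1:
  assumes "CARD('d::finite) = 1"
  shows "card (sphere_sites m :: (nat ^ 'd) set) \<le> 1"
proof -
  obtain a :: 'd where "UNIV = {a}" using assms by (auto simp: card_1_singleton_iff)
  then have all_eq: "j = k" for j k :: 'd by (metis UNIV_I singletonD)
  have "sphere_sites m \<subseteq> {\<chi> k :: 'd. m}"
    unfolding sphere_sites_def by (auto simp: vec_eq_iff) (metis all_eq)
  then show ?thesis using card_mono[of "{\<chi> k :: 'd. m}"] by simp
qed

text \<open>Telescoping of \<open>ln (1 + 1 / k) \<le> 1 / k\<close>. It turns the exponential of a
  harmonic sum into a power of \<open>m\<close>.\<close>

lemma ln_diff_le_sum_inverse:
  assumes "1 \<le> t" "t \<le> m"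
  shows "ln (real (m + 1)) - ln (real t) \<le> (\<Sum>k=t..m. 1 / real k)"
proof -
  have increment: "ln (real (k + 1)) - ln (real k) \<le> 1 / real k" if "k \<ge> 1" for k
  proof -
    have "ln (real (k + 1)) - ln (real k) = ln (real (k + 1) / real k)"
      using that by (simp add: ln_div)
    also have "\<dots> \<le> real (k + 1) / real k - 1"
      using that by (intro ln_le_minus_one) simp
    also have "\<dots> = 1 / real k"
      using that by (simp add: field_simps)
    finally show ?thesis .
  qed
  show ?thesis
    using assms(2)
  proof (induction m rule: dec_induct)
    case base
    then show ?case using increment[OF assms(1)] by simp
  next
    case (step k)
    then show ?case using increment[of "Suc k"] by simp
  qed
qed

section \<open>Reach of a site\<close>

context coverage_model
begin

text \<open>Site \<open>i\<close> covers a point at sup-distance \<open>k\<close> in the positive orthant from it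
  iff \<open>k < reach i \<omega>\<close>.\<close>

definition reach :: "nat ^ 'd \<Rightarrow> 'a \<Rightarrow> nat" where
  "reach i \<omega> = (if X i \<omega> = 1 then Suc (R i \<omega>) else 0)"

definition cover_prob :: "nat \<Rightarrow> real" where
  "cover_prob k = p * measure N {\<omega> \<in> space N. k \<le> rho \<omega>}"

lemma less_reach_iff: "k < reach i \<omega> \<longleftrightarrow> X i \<omega> = 1 \<and> k \<le> R i \<omega>"
  by (auto simp: reach_def)

lemma measurable_reach [measurable]: "reach i \<in> measurable M (count_space UNIV)"
  unfolding reach_def by measurable

lemma prob_R_ge: "prob {\<omega> \<in> space M. k \<le> R i \<omega>} = measure N {\<omega> \<in> space N. k \<le> rho \<omega>}"
proof -
  have "prob {\<omega> \<in> space M. k \<le> R i \<omega>} = measure (distr M (count_space UNIV) (R i)) {k..}"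
    by (subst measure_distr) (auto intro!: arg_cong[where f = prob])
  also have "\<dots> = measure N {\<omega> \<in> space N. k \<le> rho \<omega>}"
    unfolding R_distr using rho_measurable
    by (subst measure_distr) (auto intro!: arg_cong[where f = "measure N"])
  finally show ?thesis .
qed

text \<open>The event splits into one about the field \<open>X\<close> and one about the field
  \<open>R\<close>, and each factorises over \<open>J\<close>. Joint tails give both the marginal
  law and the independence of \<open>reach\<close>.\<close>

lemma prob_all_less_reach:
  assumes "finite J"
  shows "prob {\<omega> \<in> space M. \<forall>j\<in>J. k j < reach j \<omega>} = (\<Prod>j\<in>J. cover_prob (k j))"
proof -
  let ?P = "Pi\<^sub>M UNIV (\<lambda>_::nat ^ 'd. count_space (UNIV :: nat set))"
  let ?X = "\<lambda>\<omega> i. X i \<omega>" and ?R = "\<lambda>\<omega> i. R i \<omega>"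
  define A where "A = {x \<in> space ?P. \<forall>j\<in>J. x j \<in> {1}}"
  define B where "B = {x \<in> space ?P. \<forall>j\<in>J. x j \<in> {k j..}}"
  have [measurable]: "Measurable.pred ?P (\<lambda>x. x j \<in> D)" for j D
    by (rule measurable_compose[OF measurable_component_singleton[of j]]) simp_all
  have [measurable]: "A \<in> sets ?P" "B \<in> sets ?P"
    unfolding A_def B_def using assms by measurable
  have "{\<omega> \<in> space M. \<forall>j\<in>J. k j < reach j \<omega>} = (\<lambda>\<omega>. (?X \<omega>, ?R \<omega>)) -` (A \<times> B) \<inter> space M"
    by (auto simp: less_reach_iff A_def B_def space_PiM)
  then have "prob {\<omega> \<in> space M. \<forall>j\<in>J. k j < reach j \<omega>} = prob (?X -` A \<inter> space M) * prob (?R -` B \<inter> space M)"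
    using indep_varD[OF X_R_indep, of A B] by simp
  also have "?X -` A \<inter> space M = {\<omega> \<in> space M. \<forall>j\<in>J. X j \<omega> \<in> {1}}"
    by (auto simp: A_def space_PiM)
  also have "prob \<dots> = (\<Prod>j\<in>J. p)"
    using X_indep assms X_one by (subst prob_all_in_eq_prod) auto
  also have "?R -` B \<inter> space M = {\<omega> \<in> space M. \<forall>j\<in>J. R j \<omega> \<in> {k j..}}"
    by (auto simp: B_def space_PiM)
  also have "prob \<dots> = (\<Prod>j\<in>J. measure N {\<omega> \<in> space N. k j \<le> rho \<omega>})"
    using R_indep assms by (subst prob_all_in_eq_prod) (auto simp: prob_R_ge)
  finally show ?thesis
    by (simp add: cover_prob_def prod.distrib)
qed

lemma prob_less_reach: "prob {\<omega> \<in> space M. k < reach i \<omega>} = cover_prob k"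
  using prob_all_less_reach[of "{i}" "\<lambda>_. k"] by simp

lemma prob_reach_le: "prob {\<omega> \<in> space M. reach i \<omega> \<le> k} = 1 - cover_prob k"
proof -
  have "{\<omega> \<in> space M. reach i \<omega> \<le> k} = space M - {\<omega> \<in> space M. k < reach i \<omega>}" by auto
  then show ?thesis by (simp add: prob_compl prob_less_reach)
qed

lemma cover_prob_bounds: "0 \<le> cover_prob k" "cover_prob k \<le> 1"
  unfolding prob_less_reach[of k undefined, symmetric] by auto

text \<open>The events \<open>k < reach i \<omega>\<close> are stable under intersection and
  generate all events about \<open>reach i\<close>, so the product formula for them
  suffices.\<close>

lemma indep_reach: "indep_vars (\<lambda>_. count_space UNIV) reach UNIV"
proof -
  define F where "F i = {{\<omega> \<in> space M. k < reach i \<omega>} | k. True}" for i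
  have F_events: "F i \<subseteq> events" for i
    unfolding F_def by auto
  have "indep_sets F UNIV"
  proof (rule indep_setsI)
    fix A and J :: "(nat ^ 'd) set"
    assume J: "J \<noteq> {}" "finite J" and "\<forall>j\<in>J. A j \<in> F j"
    then have "\<forall>j\<in>J. \<exists>k. A j = {\<omega> \<in> space M. k < reach j \<omega>}"
      by (auto simp: F_def)
    then obtain k where k: "\<And>j. j \<in> J \<Longrightarrow> A j = {\<omega> \<in> space M. k j < reach j \<omega>}"
      by metis
    have "(\<Inter>j\<in>J. A j) = {\<omega> \<in> space M. \<forall>j\<in>J. k j < reach j \<omega>}"
      using J k by auto
    then show "prob (\<Inter>j\<in>J. A j) = (\<Prod>j\<in>J. prob (A j))"
      using J by (simp add: prob_all_less_reach prob_less_reach k)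
  qed (rule F_events)
  then have "indep_sets (\<lambda>i. sigma_sets (space M) (F i)) UNIV"
  proof (rule indep_sets_sigma)
    fix i
    have "{\<omega> \<in> space M. k < reach i \<omega>} \<inter> {\<omega> \<in> space M. l < reach i \<omega>}
        = {\<omega> \<in> space M. max k l < reach i \<omega>}" for k l
      by auto
    then show "Int_stable (F i)"
      unfolding Int_stable_def F_def by blast
  qed
  then have "indep_sets (\<lambda>i. {reach i -` A \<inter> space M |A. A \<in> sets (count_space UNIV)}) UNIV"
  proof (rule indep_sets_mono_sets)
    fix i
    let ?S = "sigma (space M) (F i)"
    have sub: "F i \<subseteq> Pow (space M)" by (auto simp: F_def)
    have gt: "{\<omega> \<in> space M. k < reach i \<omega>} \<in> sets ?S" for k
      using sub by (auto simp: F_def intro!: sigma_sets.Basic)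
    have "reach i \<in> measurable ?S (count_space UNIV)"
    proof (subst measurable_count_space_eq2_countable, intro conjI ballI)
      fix k
      \<comment> \<open>A singleton is a difference of two tails; for \<open>k = 0\<close> the
        larger one is the whole space.\<close>
      have "reach i -` {k} \<inter> space ?S = (case k of 0 \<Rightarrow> space M | Suc j \<Rightarrow> {\<omega> \<in> space M. j < reach i \<omega>})
          - {\<omega> \<in> space M. k < reach i \<omega>}"
        using sub by (auto simp: space_measure_of split: nat.splits)
      also have "\<dots> \<in> sets ?S"
        using gt sets.top[of ?S] sub by (auto simp: space_measure_of simp del: sets_measure_of split: nat.splits)
      finally show "reach i -` {k} \<inter> space ?S \<in> sets ?S" .
    qed auto
    then have "reach i -` A \<inter> space M \<in> sigma_sets (space M) (F i)" for A
      using measurable_sets[of "reach i" ?S "count_space UNIV" A] sub by (simp add: space_measure_of)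
    then show "{reach i -` A \<inter> space M |A. A \<in> sets (count_space UNIV)} \<subseteq> sigma_sets (space M) (F i)"
      by auto
  qed
  then show ?thesis
    unfolding indep_vars_def2 by simp
qed

section \<open>Coverage: failure probability of a point, and Borel-Cantelli over shells\<close>

lemma doubly_covered_event:
  "{\<omega> \<in> space M. real_vec n \<in> doubly_covered_set (\<lambda>i. X i \<omega>) (\<lambda>i. R i \<omega>)} \<in> events"
proof -
  have [measurable]: "{\<omega> \<in> space M. y \<in> site_box i (R i \<omega>)} \<in> events" for y and i :: "nat ^ 'd"
    by measurable
  show ?thesis
    unfolding doubly_covered_set_def mem_Collect_eq Int_iff by measurable
qed

text \<open>The sites used lie \<open>k \<ge> t\<close> steps behind \<open>n\<close> along axis
  \<open>a\<close> and \<open>s < w\<close> steps behind along axis \<open>b\<close>. As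
  \<open>s < w \<le> t \<le> k\<close>, their sup-distance to \<open>n\<close> is \<open>k\<close>,
  so each of the \<open>w\<close> rows contributes the same sum of \<open>cover_prob k\<close>, at
  least \<open>c\<close> times a harmonic sum. For \<open>w = 1\<close> there is one row and
  \<open>b\<close> may equal \<open>a\<close>, as in dimension one.\<close>

lemma prob_not_doubly_covered_le:
  fixes n :: "nat ^ 'd" and \<theta> c :: real
  assumes \<theta>: "0 < \<theta>" "\<theta> < 1"
    and t: "1 \<le> t" "w \<le> t" "\<And>k. t \<le> n $ k"
    and c: "\<And>k. k \<ge> t \<Longrightarrow> c / real k \<le> cover_prob k" "0 \<le> c"
    and ab: "b \<noteq> a \<or> w = 1"
  shows "prob {\<omega> \<in> space M. real_vec n \<notin> doubly_covered_set (\<lambda>i. X i \<omega>) (\<lambda>i. R i \<omega>)}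
    \<le> exp (- (1 - \<theta>) * (real w * c * (ln (real (n $ a + 1)) - ln (real t)))) / \<theta>"
proof -
  define site where "site = (\<lambda>(k, s). \<chi> j. if j = a then n $ a - k else if j = b then n $ b - s else n $ j)"
  define I where "I = {t..n $ a} \<times> {..<w}"
  define S where "S = site ` I"
  have site_a: "site (k, s) $ a = n $ a - k" for k s
    by (simp add: site_def)
  have inj: "inj_on site I"
  proof (rule inj_onI, clarify)
    fix k s k' s' assume ks: "(k, s) \<in> I" "(k', s') \<in> I" and eq: "site (k, s) = site (k', s')"
    have "n $ a - k = n $ a - k'" using eq by (metis site_a)
    then have "k = k'" using ks by (auto simp: I_def)
    moreover have "s = s'"
    proof (cases "b = a")
      case True
      then show ?thesis using ab ks by (auto simp: I_def)
    next
      case False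
      then have "n $ b - s = n $ b - s'"
        using arg_cong[OF eq, of "\<lambda>v. v $ b"] by (simp add: site_def)
      then show ?thesis using ks t(2) t(3)[of b] by (auto simp: I_def)
    qed
    ultimately show "k = k' \<and> s = s'" by simp
  qed
  have fin: "finite S" by (simp add: S_def I_def)
  have covers: "X i \<omega> = 1 \<and> real_vec n \<in> site_box i (R i \<omega>)"
    if i_reach: "i \<in> S" "n $ a - i $ a < reach i \<omega>" for i \<omega>
  proof -
    obtain k s where i: "i = site (k, s)" "t \<le> k" "k \<le> n $ a" "s < w"
      using i_reach(1) by (auto simp: S_def I_def)
    then have "X i \<omega> = 1" "k \<le> R i \<omega>"
      using i_reach(2) by (auto simp: site_a less_reach_iff)
    then show ?thesis
      using i t(2) by (auto simp: real_vec_in_site_box_iff site_def)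
  qed
  have [measurable]: "Measurable.pred M (\<lambda>\<omega>. reach x \<omega> \<in> D)" for x D
    by (rule measurable_compose[OF measurable_reach]) simp
  \<comment> \<open>Two distinct sites of \<open>S\<close> reaching \<open>n\<close> would cover it
    doubly, so failure leaves at most one.\<close>
  have "prob {\<omega> \<in> space M. real_vec n \<notin> doubly_covered_set (\<lambda>i. X i \<omega>) (\<lambda>i. R i \<omega>)}
      \<le> prob {\<omega> \<in> space M. \<forall>x\<in>S. \<forall>y\<in>S. reach x \<omega> \<in> {n $ a - x $ a<..} \<longrightarrow>
          reach y \<omega> \<in> {n $ a - y $ a<..} \<longrightarrow> x = y}"
  proof (rule finite_measure_mono)
    show "{\<omega> \<in> space M. real_vec n \<notin> doubly_covered_set (\<lambda>i. X i \<omega>) (\<lambda>i. R i \<omega>)}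
      \<subseteq> {\<omega> \<in> space M. \<forall>x\<in>S. \<forall>y\<in>S. reach x \<omega> \<in> {n $ a - x $ a<..} \<longrightarrow>
          reach y \<omega> \<in> {n $ a - y $ a<..} \<longrightarrow> x = y}"
      using covers unfolding doubly_covered_set_def by blast
  qed (use fin in measurable)
  also have "\<dots> \<le> exp (- (1 - \<theta>) * (\<Sum>x\<in>S. prob {\<omega> \<in> space M. reach x \<omega> \<in> {n $ a - x $ a<..}})) / \<theta>"
    by (intro prob_at_most_one_le indep_vars_subset[OF indep_reach] fin \<theta>) auto
  also have "(\<Sum>x\<in>S. prob {\<omega> \<in> space M. reach x \<omega> \<in> {n $ a - x $ a<..}}) = (\<Sum>x\<in>S. cover_prob (n $ a - x $ a))"
    by (simp add: prob_less_reach)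
  also have "\<dots> = (\<Sum>(k, s)\<in>I. cover_prob k)"
    unfolding S_def using inj by (subst sum.reindex) (auto simp: site_a I_def intro!: sum.cong)
  also have "\<dots> = real w * (\<Sum>k=t..n $ a. cover_prob k)"
    by (simp add: I_def sum.cartesian_product[symmetric] sum_distrib_left)
  also have "exp (- (1 - \<theta>) * (real w * (\<Sum>k=t..n $ a. cover_prob k))) / \<theta>
      \<le> exp (- (1 - \<theta>) * (real w * c * (ln (real (n $ a + 1)) - ln (real t)))) / \<theta>"
  proof -
    have "c * (ln (real (n $ a + 1)) - ln (real t)) \<le> c * (\<Sum>k=t..n $ a. 1 / real k)"
      using ln_diff_le_sum_inverse[OF t(1) t(3)] c(2) by (intro mult_left_mono) auto
    also have "\<dots> = (\<Sum>k=t..n $ a. c / real k)"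
      by (simp add: sum_distrib_left)
    also have "\<dots> \<le> (\<Sum>k=t..n $ a. cover_prob k)"
      using c(1) by (intro sum_mono) auto
    finally have "real w * (c * (ln (real (n $ a + 1)) - ln (real t))) \<le> real w * (\<Sum>k=t..n $ a. cover_prob k)"
      by (intro mult_left_mono) auto
    then have "(1 - \<theta>) * (real w * (c * (ln (real (n $ a + 1)) - ln (real t))))
        \<le> (1 - \<theta>) * (real w * (\<Sum>k=t..n $ a. cover_prob k))"
      by (rule mult_left_mono) (use \<theta> in simp)
    then have "- (1 - \<theta>) * (real w * (\<Sum>k=t..n $ a. cover_prob k))
        \<le> - (1 - \<theta>) * (real w * c * (ln (real (n $ a + 1)) - ln (real t)))"
      by (simp only: mult_minus_left neg_le_iff_le mult.assoc)
    then show ?thesis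
      by (intro divide_right_mono exp_le_cancel_iff[THEN iffD2]) (use \<theta>(1) in simp_all)
  qed
  finally show ?thesis .
qed

text \<open>A union bound over the shell \<open>m\<close> gives failure probability at most a
  constant times \<open>(m + 1) powr (e - \<beta>)\<close> with
  \<open>\<beta> = (1 - \<theta>) * (w * c)\<close>, summable by \<open>exponent\<close>. Dimension
  one will take \<open>e = 0\<close> and \<open>w = 1\<close>, higher dimensions many rows.\<close>

lemma AE_eventually_doubly_covered:
  fixes \<theta> c :: real and e t w :: nat
  assumes \<theta>: "0 < \<theta>" "\<theta> < 1" and t: "1 \<le> t" "w \<le> t"
    and c: "\<And>k. k \<ge> t \<Longrightarrow> c / real k \<le> cover_prob k" "0 \<le> c"
    and lanes: "2 \<le> CARD('d) \<or> w = 1"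
    and card: "\<And>m. card (sphere_sites m :: (nat ^ 'd) set) \<le> (m + 1) ^ e"
    and exponent: "real e + 1 < (1 - \<theta>) * (real w * c)"
  shows "AE \<omega> in M. eventually_doubly_covered (\<lambda>i. X i \<omega>) (\<lambda>i. R i \<omega>)"
proof -
  define \<beta> where "\<beta> = (1 - \<theta>) * (real w * c)"
  define C where "C = exp (\<beta> * ln (real t)) / \<theta>"
  define bad where "bad n = {\<omega> \<in> space M. real_vec n \<notin> doubly_covered_set (\<lambda>i. X i \<omega>) (\<lambda>i. R i \<omega>)}"
    for n :: "nat ^ 'd"
  define S where "S m = {n :: nat ^ 'd. n \<in> sphere_sites m \<and> (\<forall>k. t \<le> n $ k)}" for m
  define A where "A m = (\<Union>n\<in>S m. bad n)" for m
  have S_sub: "S m \<subseteq> sphere_sites m" for m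
    by (auto simp: S_def)
  have fin: "finite (S m)" for m
    using finite_subset[OF S_sub finite_sphere_sites] .
  have [measurable]: "bad n \<in> events" for n
  proof -
    have "bad n = space M - {\<omega> \<in> space M. real_vec n \<in> doubly_covered_set (\<lambda>i. X i \<omega>) (\<lambda>i. R i \<omega>)}"
      by (auto simp: bad_def)
    then show ?thesis using doubly_covered_event by simp
  qed
  have A_ev: "A m \<in> events" for m
    unfolding A_def using fin by measurable
  have bad_le: "prob (bad n) \<le> C * real (m + 1) powr (-\<beta>)" if n: "n \<in> S m" for n m
  proof -
    \<comment> \<open>The rows run along an axis on which \<open>n\<close> attains its largest
      coordinate, so the bound depends on \<open>m\<close> only.\<close>
    obtain a where a: "n $ a = m" using n by (auto simp: S_def sphere_sites_def)
    obtain b where "b \<noteq> a \<or> w = 1"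
    proof (cases "w = 1")
      case False
      then have "2 \<le> CARD('d)" using lanes by simp
      then have "UNIV \<noteq> {a}" by (metis card.empty card.insert card_eq_0_iff One_nat_def Suc_1 not_less_eq_eq empty_iff finite.emptyI order_refl)
      then show ?thesis using that by blast
    qed (use that in blast)
    then have "prob (bad n) \<le> exp (- (1 - \<theta>) * (real w * c * (ln (real (n $ a + 1)) - ln (real t)))) / \<theta>"
      unfolding bad_def using n by (intro prob_not_doubly_covered_le \<theta> t c) (auto simp: S_def)
    also have "- (1 - \<theta>) * (real w * c * (ln (real (n $ a + 1)) - ln (real t)))
        = \<beta> * ln (real t) + (-\<beta>) * ln (real (m + 1))"
      unfolding a by (simp add: \<beta>_def algebra_simps)
    also have "exp \<dots> / \<theta> = C * real (m + 1) powr (-\<beta>)"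
      by (simp add: C_def powr_def exp_add[symmetric])
    finally show ?thesis .
  qed
  have C0: "C \<ge> 0" using \<theta> by (simp add: C_def)
  have A_le: "prob (A m) \<le> C * real (Suc m) powr (real e - \<beta>)" for m
  proof -
    have "prob (A m) \<le> (\<Sum>n\<in>S m. prob (bad n))"
      unfolding A_def using fin by (intro finite_measure_subadditive_finite) auto
    also have "\<dots> \<le> (\<Sum>n\<in>S m. C * real (m + 1) powr (-\<beta>))"
      by (intro sum_mono bad_le)
    also have "\<dots> = real (card (S m)) * (C * real (m + 1) powr (-\<beta>))"
      by simp
    also have "\<dots> \<le> real ((m + 1) ^ e) * (C * real (m + 1) powr (-\<beta>))"
      using card_mono[OF finite_sphere_sites S_sub[of m]] card[of m] C0
      by (intro mult_right_mono of_nat_mono) (auto intro: order_trans)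
    also have "\<dots> = C * real (Suc m) powr (real e - \<beta>)"
      by (simp add: powr_diff powr_minus powr_realpow field_simps)
    finally show ?thesis .
  qed
  have "summable (\<lambda>m. real (Suc m) powr (real e - \<beta>))"
    using exponent by (subst summable_Suc_iff) (simp add: summable_real_powr_iff \<beta>_def)
  then have "summable (\<lambda>m. C * real (Suc m) powr (real e - \<beta>))"
    by (rule summable_mult)
  then have "summable (\<lambda>m. prob (A m))"
    by (rule summable_comparison_test'[where N = 0]) (simp add: A_le del: of_nat_Suc)
  then have "AE \<omega> in M. eventually (\<lambda>m. \<omega> \<in> space M - A m) sequentially"
    using A_ev by (intro borel_cantelli_AE1) (auto simp: emeasure_eq_measure)
  then show ?thesis
  proof eventually_elim
    case (elim \<omega>)
    then obtain m0 where m0: "\<And>m. m \<ge> m0 \<Longrightarrow> \<omega> \<in> space M - A m"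
      by (auto simp: eventually_sequentially)
    have "real_vec n \<in> doubly_covered_set (\<lambda>i. X i \<omega>) (\<lambda>i. R i \<omega>)"
      if n: "\<And>k. max t m0 \<le> n $ k" for n :: "nat ^ 'd"
    proof -
      define m where "m = Max (range (vec_nth n))"
      have "m \<in> range (vec_nth n)" unfolding m_def by (intro Max_in) auto
      moreover have "n $ k \<le> m" for k unfolding m_def by (intro Max_ge) auto
      ultimately have "n \<in> S m"
        using n by (auto simp: S_def sphere_sites_def)
      moreover have "m \<ge> m0"
        using n[of undefined] \<open>n $ undefined \<le> m\<close> by simp
      ultimately show ?thesis using m0[of m] by (auto simp: A_def bad_def)
    qed
    then show ?case
      unfolding eventually_doubly_covered_iff
      by (intro exI[of _ "\<chi> k. max t m0"]) simp
  qed
qed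

text \<open>Reduction to renewals on the line in direction \<open>a\<close> whose other coordinates
  all equal \<open>t\<close>. \<open>L t\<close> holds the feet of the parallel lines containing
  every site that can cover a point of it; \<open>Z t c\<close>, defined in the proof, is the
  largest reach in the slice at height \<open>c\<close>. Different slices are independent.\<close>

lemma AE_not_eventually_doubly_covered:
  fixes a :: 'd
  defines "L \<equiv> \<lambda>t. {l :: nat ^ 'd. l $ a = 0 \<and> (\<forall>k. k \<noteq> a \<longrightarrow> l $ k \<le> t)}"
  assumes q1: "cover_prob 1 < 1"
    and tail: "\<And>t. eventually (\<lambda>k. real (card (L t)) * cover_prob k * real k \<le> 1) sequentially"
  shows "AE \<omega> in M. \<not> eventually_doubly_covered (\<lambda>i. X i \<omega>) (\<lambda>i. R i \<omega>)"
proof -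
  define site where "site c l = (\<chi> k. if k = a then c else l $ k)" for c and l :: "nat ^ 'd"
  define Z where "Z t c \<omega> = Max ((\<lambda>l. reach (site c l) \<omega>) ` L t)" for t c \<omega>
  have finL: "finite (L t)" for t
  proof (rule finite_imageD)
    show "finite (vec_nth ` L t)"
      by (rule finite_subset[OF _ finite_PiE[of UNIV "\<lambda>_. {..t}"]]) (auto simp: L_def, metis le0)
    show "inj_on vec_nth (L t)" by (auto simp: inj_on_def vec_nth_inject)
  qed
  have L_ne: "L t \<noteq> {}" for t
  proof -
    have "0 \<in> L t" by (simp add: L_def)
    then show ?thesis by blast
  qed
  have "AE \<omega> in M. \<exists>\<^sub>\<infinity>m. \<forall>c\<le>m. Z t c \<omega> \<le> max 1 (m - c)" for t
  proof (rule AE_infinitely_many_renewals[where F = "\<lambda>k. (1 - cover_prob k) ^ card (L t)"])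
    have inj: "inj_on (site c) (L t)" for c
      unfolding inj_on_def L_def site_def by (simp add: vec_eq_iff) metis
    have site_a: "site c l $ a = c" for c l by (simp add: site_def)
    have "indep_vars (\<lambda>c. Pi\<^sub>M (site c ` L t) (\<lambda>_. count_space UNIV))
        (\<lambda>c \<omega>. restrict (\<lambda>i. reach i \<omega>) (site c ` L t)) UNIV"
      by (intro indep_vars_restrict[OF indep_reach]) (auto simp: disjoint_family_on_def, metis site_a)
    \<comment> \<open>The maximum is taken over a set comprehension, the form in which the
      measurability rule for \<open>Max\<close> applies.\<close>
    then have "indep_vars (\<lambda>_. count_space UNIV)
        (\<lambda>c \<omega>. Max {k. \<exists>l\<in>L t. k = (restrict (\<lambda>i. reach i \<omega>) (site c ` L t)) (site c l)}) UNIV"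
    proof (rule indep_vars_compose2)
      fix c
      have "(\<lambda>z. z (site c l)) \<in> measurable (Pi\<^sub>M (site c ` L t) (\<lambda>_. count_space UNIV)) (count_space (UNIV :: nat set))"
        if "l \<in> L t" for l
        using that by (intro measurable_component_singleton) auto
      then show "(\<lambda>z. Max {k. \<exists>l\<in>L t. k = z (site c l)})
          \<in> measurable (Pi\<^sub>M (site c ` L t) (\<lambda>_. count_space UNIV)) (count_space (UNIV :: nat set))"
        using finL by (intro measurable_Max_nat pred_intros_finite) measurable
    qed
    moreover have "Max {k. \<exists>l\<in>L t. k = (restrict (\<lambda>i. reach i \<omega>) (site c ` L t)) (site c l)} = Z t c \<omega>" for c \<omega>
      unfolding Z_def by (intro arg_cong[where f = Max]) auto
    ultimately show "indep_vars (\<lambda>_. count_space UNIV) (Z t) UNIV"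
      by simp
    show "prob {\<omega> \<in> space M. Z t c \<omega> \<le> k} = (1 - cover_prob k) ^ card (L t)" for c k
    proof -
      have "prob {\<omega> \<in> space M. Z t c \<omega> \<le> k} = prob {\<omega> \<in> space M. \<forall>i\<in>site c ` L t. reach i \<omega> \<in> {..k}}"
        using finL L_ne by (simp add: Z_def)
      also have "\<dots> = (\<Prod>i\<in>site c ` L t. 1 - cover_prob k)"
        using finL by (subst prob_all_in_eq_prod[OF indep_reach]) (auto simp: prob_reach_le)
      also have "\<dots> = (1 - cover_prob k) ^ card (L t)"
        by (simp add: card_image inj)
      finally show ?thesis .
    qed
    show "0 < (1 - cover_prob 1) ^ card (L t)" using q1 by simp
    show "\<forall>\<^sub>F k in sequentially. 1 - 1 / real k \<le> (1 - cover_prob k) ^ card (L t)"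
      using tail[of t] eventually_gt_at_top[of 0]
    proof eventually_elim
      case (elim k)
      have "1 - 1 / real k \<le> 1 + real (card (L t)) * (- cover_prob k)"
        using elim by (simp add: field_simps)
      also have "\<dots> \<le> (1 + (- cover_prob k)) ^ card (L t)"
        using cover_prob_bounds[of k] by (intro Bernoulli_inequality) simp
      finally show ?case by simp
    qed
  qed
  \<comment> \<open>The choice of \<open>t\<close> below depends on the outcome, so one null set
    must serve every \<open>t\<close>.\<close>
  then have "AE \<omega> in M. \<forall>t. \<exists>\<^sub>\<infinity>m. \<forall>c\<le>m. Z t c \<omega> \<le> max 1 (m - c)"
    by (subst AE_all_countable) simp
  then show ?thesis
  proof eventually_elim
    case (elim \<omega>)
    show ?case
    proof
      assume "eventually_doubly_covered (\<lambda>i. X i \<omega>) (\<lambda>i. R i \<omega>)"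
      then obtain v :: "nat ^ 'd" where
        v: "\<And>n. (\<And>k. v $ k \<le> n $ k) \<Longrightarrow> real_vec n \<in> doubly_covered_set (\<lambda>i. X i \<omega>) (\<lambda>i. R i \<omega>)"
        unfolding eventually_doubly_covered_iff by auto
      define t where "t = (\<Sum>k\<in>UNIV. v $ k)"
      have vt: "v $ k \<le> t" for k
        unfolding t_def by (rule member_le_sum) auto
      obtain m where m: "m \<ge> t" "\<forall>c\<le>m. Z t c \<omega> \<le> max 1 (m - c)"
        using elim unfolding INFM_nat_le by blast
      define n where "n = (\<chi> k. if k = a then m else t)"
      have "real_vec n \<in> doubly_covered_set (\<lambda>i. X i \<omega>) (\<lambda>i. R i \<omega>)"
        using vt m(1) by (intro v) (auto simp: n_def intro: order_trans)
      then obtain i j where "i \<noteq> j" "X i \<omega> = 1" "real_vec n \<in> site_box i (R i \<omega>)"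
          "X j \<omega> = 1" "real_vec n \<in> site_box j (R j \<omega>)"
        unfolding doubly_covered_set_def by blast
      \<comment> \<open>Of two distinct covering sites one is not \<open>n\<close> itself, which is
        why renewals may tolerate radius 0 at \<open>n\<close>.\<close>
      then have "\<exists>i. i \<noteq> n \<and> X i \<omega> = 1 \<and> real_vec n \<in> site_box i (R i \<omega>)"
        by metis
      then obtain i where i: "i \<noteq> n" "X i \<omega> = 1" "\<And>k. i $ k \<le> n $ k" "\<And>k. n $ k \<le> i $ k + R i \<omega>"
        by (auto simp: real_vec_in_site_box_iff)
      \<comment> \<open>A covering site other than \<open>n\<close> has radius at least 1. Hence
        \<open>max 1 (m - i $ a) \<le> R i \<omega> < reach i \<omega>\<close>, against the renewal
        at \<open>m\<close>.\<close>
      obtain k where "i $ k \<noteq> n $ k" using i(1) by (auto simp: vec_eq_iff)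
      then have R: "R i \<omega> \<ge> 1" "R i \<omega> \<ge> m - i $ a" "i $ a \<le> m"
        using i(3)[of k] i(4)[of k] i(3)[of a] i(4)[of a] by (auto simp: n_def)
      define l where "l = (\<chi> k. if k = a then 0 else i $ k)"
      have l: "l \<in> L t" "site (i $ a) l = i"
        using i(3) by (auto simp: L_def l_def site_def n_def vec_eq_iff) (metis i(3))
      have "reach i \<omega> \<le> Z t (i $ a) \<omega>"
        unfolding Z_def using l finL by (intro Max_ge) force+
      also have "\<dots> \<le> max 1 (m - i $ a)"
        using m(2) R(3) by blast
      also have "\<dots> \<le> R i \<omega>" using R by simp
      finally show False using i(2) by (simp add: reach_def)
    qed
  qed
qed

end

section \<open>Eventual double coverage\<close>

(* The side condition in the last case only excludes p = 1 together with rho >= 1 a.s.; there every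
   point of (1,...,1) + N^d is doubly covered, whatever the tail of rho. *)
theorem proposition3:
  fixes M :: "'a measure" and N :: "'b measure" and p :: real
    and rho :: "'b \<Rightarrow> nat"
    and X R :: "nat ^ 'd::finite \<Rightarrow> 'a \<Rightarrow> nat"
  assumes model: "coverage_model M p N rho X R"
  shows
    "(CARD('d) = 1 \<longrightarrow>
       (\<forall>l L :: ereal.
          l = liminf (\<lambda>j. ereal (real j * \<P>(\<omega> in N. rho \<omega> \<ge> j))) \<longrightarrow>
          L = limsup (\<lambda>j. ereal (real j * \<P>(\<omega> in N. rho \<omega> \<ge> j))) \<longrightarrow>
          l > 1 \<longrightarrow> L < \<infinity> \<longrightarrow>
          (ereal p > 1 / l \<longrightarrow>
             \<P>(\<omega> in M. eventually_doubly_covered (\<lambda>i. X i \<omega>) (\<lambda>i. R i \<omega>)) = 1) \<and>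
          (ereal p < 1 / L \<longrightarrow>
             \<P>(\<omega> in M. eventually_doubly_covered (\<lambda>i. X i \<omega>) (\<lambda>i. R i \<omega>)) = 0))) \<and>
     (CARD('d) \<ge> 2 \<longrightarrow> p > 0 \<longrightarrow>
       (liminf (\<lambda>j. ereal (real j * \<P>(\<omega> in N. rho \<omega> \<ge> j))) > 0 \<longrightarrow>
          \<P>(\<omega> in M. eventually_doubly_covered (\<lambda>i. X i \<omega>) (\<lambda>i. R i \<omega>)) = 1) \<and>
       ((\<lambda>j. real j * \<P>(\<omega> in N. rho \<omega> \<ge> j)) \<longlonglongrightarrow> 0 \<longrightarrow>
        \<not> (p = 1 \<and> (AE \<omega> in N. rho \<omega> \<ge> 1)) \<longrightarrow>
          \<P>(\<omega> in M. eventually_doubly_covered (\<lambda>i. X i \<omega>) (\<lambda>i. R i \<omega>)) = 0))"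
proof -
  interpret coverage_model M p N rho X R by (rule model)
  interpret N: prob_space N by (rule prob_space_N)
  let ?P = "\<lambda>j. \<P>(\<omega> in N. rho \<omega> \<ge> j)"
  let ?edc = "\<lambda>\<omega>. eventually_doubly_covered (\<lambda>i. X i \<omega>) (\<lambda>i. R i \<omega>)"
  note prob_1 = prob_Collect_eq_1[OF eventually_doubly_covered_event, THEN iffD2]
  note prob_0 = prob_Collect_eq_0[OF eventually_doubly_covered_event, THEN iffD2]
  have tail_lower: "\<exists>J. \<forall>k\<ge>J. p * c / real k \<le> cover_prob k"
    if "ereal c < liminf (\<lambda>j. ereal (real j * ?P j))" for c
  proof -
    have "eventually (\<lambda>k. p * c / real k \<le> cover_prob k) sequentially"
      using less_LiminfD[OF that] eventually_gt_at_top[of 0]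
    proof eventually_elim
      case (elim k)
      then have "p * c \<le> p * (real k * ?P k)"
        using p_range by (intro mult_left_mono) auto
      then show ?case using elim by (simp add: cover_prob_def field_simps)
    qed
    then show ?thesis by (simp add: eventually_sequentially)
  qed
  have cover_prob_1: "cover_prob 1 < 1" if "\<not> (p = 1 \<and> (AE \<omega> in N. rho \<omega> \<ge> 1))"
  proof (cases "p = 1")
    case True
    have "{\<omega> \<in> space N. rho \<omega> \<ge> 1} \<in> sets N"
      using measurable_sets[OF rho_measurable, of "{1..}"] by (simp add: vimage_def Int_def conj_commute)
    from N.prob_Collect_eq_1[OF this] have "?P 1 \<noteq> 1"
      using that True by simp
    then have "?P 1 < 1"
      using N.prob_le_1[of "{\<omega> \<in> space N. rho \<omega> \<ge> 1}"] by (simp add: less_le)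
    then show ?thesis
      unfolding cover_prob_def using True by simp
  next
    case False
    have "cover_prob 1 \<le> p * 1"
      unfolding cover_prob_def using p_range by (intro mult_left_mono) auto
    then show ?thesis using False p_range by simp
  qed
  show ?thesis
  proof (intro conjI impI allI)
    fix l L :: ereal
    assume d: "CARD('d) = 1"
      and l: "l = liminf (\<lambda>j. ereal (real j * ?P j))"
      and L: "L = limsup (\<lambda>j. ereal (real j * ?P j))"
      and l1: "l > 1" and L_fin: "L < \<infinity>"
    have lL: "l \<le> L" unfolding l L by (rule Liminf_le_Limsup) simp
    obtain l' where l': "l = ereal l'" "l' > 1"
      using l1 lL L_fin by (cases l) auto
    obtain L' where L': "L = ereal L'" "L' > 1"
      using l1 lL L_fin by (cases L) (use l' in auto)
    obtain a :: 'd where "UNIV = {a}" using d by (auto simp: card_1_singleton_iff)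
    then have all_a: "k = a" for k :: 'd by (metis UNIV_I singletonD)
    {
      assume "ereal p > 1 / l"
      then have p: "1 / l' < p" using l' by (simp add: one_ereal_def)
      then have p0: "p > 0" using l' by (smt (verit) divide_pos_pos)
      then have "1 / p < l'" using p l' by (simp add: field_simps)
      \<comment> \<open>With \<open>c\<close> strictly between \<open>1 / p\<close> and the liminf,
        \<open>p * c > 1\<close>; a small \<theta> then keeps
        \<open>(1 - \<theta>) * (p * c) > 1\<close>, the exponent condition for \<open>e = 0\<close>
        and \<open>w = 1\<close>.\<close>
      then obtain c where c: "1 / p < c" "c < l'" using dense by blast
      have pc: "p * c > 1" using c(1) p0 by (simp add: field_simps)
      have "ereal c < liminf (\<lambda>j. ereal (real j * ?P j))"
        unfolding l[symmetric] l'(1) using c(2) by simp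
      from tail_lower[OF this]
      obtain J where J: "\<And>k. k \<ge> J \<Longrightarrow> p * c / real k \<le> cover_prob k"
        by auto
      have "0 < 1 - 1 / (p * c)" using pc by simp
      then obtain \<theta> where \<theta>: "0 < \<theta>" "\<theta> < 1 - 1 / (p * c)" using dense by blast
      have "0 < 1 / (p * c)" using pc by simp
      then have \<theta>1: "\<theta> < 1" using \<theta>(2) by linarith
      have "1 / (p * c) < 1 - \<theta>" using \<theta>(2) by linarith
      then have \<theta>_pc: "(1 - \<theta>) * (p * c) > 1"
        using pc pos_divide_less_eq[of "p * c" 1 "1 - \<theta>"] by simp
      have "AE \<omega> in M. ?edc \<omega>"
        using \<theta>(1) \<theta>1 \<theta>_pc pc J card_sphere_sites_dim_1[OF d]
        by (intro AE_eventually_doubly_covered[where t = "max J 1" and c = "p * c" and w = 1 and e = 0 and \<theta> = \<theta>]) auto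
      then show "\<P>(\<omega> in M. ?edc \<omega>) = 1" by (rule prob_1)
    next
      assume "ereal p < 1 / L"
      then have p: "p < 1 / L'" using L' by (simp add: one_ereal_def)
      then have "p < 1" using L' by (smt (verit) divide_less_eq_1)
      then have q1: "cover_prob 1 < 1" by (intro cover_prob_1) simp
      have tail: "eventually (\<lambda>k. cover_prob k * real k \<le> 1) sequentially"
      proof (cases "p = 0")
        case False
        then have p0: "p > 0" using p_range by simp
        then have "limsup (\<lambda>j. ereal (real j * ?P j)) < ereal (1 / p)"
          using p L' L by (simp add: field_simps)
        from Limsup_lessD[OF this] show ?thesis
          by eventually_elim (use p0 in \<open>simp add: cover_prob_def field_simps\<close>)
      next
        case True
        then show ?thesis unfolding cover_prob_def by simp
      qed
      \<comment> \<open>In dimension one all sites lie on a single line, so the tail bound passes on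
        without loss.\<close>
      have card_le: "card {l :: nat ^ 'd. l $ a = 0 \<and> (\<forall>k. k \<noteq> a \<longrightarrow> l $ k \<le> t)} \<le> 1" for t
      proof -
        have "l = 0" if "l $ a = 0" for l :: "nat ^ 'd"
          using that by (simp add: vec_eq_iff) (metis all_a)
        then have "{l :: nat ^ 'd. l $ a = 0 \<and> (\<forall>k. k \<noteq> a \<longrightarrow> l $ k \<le> t)} \<subseteq> {0}"
          by auto
        from card_mono[OF _ this] show ?thesis by simp
      qed
      from tail have "eventually (\<lambda>k. real (card {l :: nat ^ 'd. l $ a = 0 \<and> (\<forall>k. k \<noteq> a \<longrightarrow> l $ k \<le> t)})
          * cover_prob k * real k \<le> 1) sequentially" for t
      proof eventually_elim
        case (elim k)
        have "real (card {l :: nat ^ 'd. l $ a = 0 \<and> (\<forall>k. k \<noteq> a \<longrightarrow> l $ k \<le> t)}) * (cover_prob k * real k)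
            \<le> 1 * (cover_prob k * real k)"
          using card_le[of t] cover_prob_bounds[of k] by (intro mult_right_mono) auto
        then show ?case using elim by (simp add: mult.assoc)
      qed
      then have "AE \<omega> in M. \<not> ?edc \<omega>"
        by (intro AE_not_eventually_doubly_covered[of a] q1)
      then show "\<P>(\<omega> in M. ?edc \<omega>) = 0" by (rule prob_0)
    }
  next
    assume d: "2 \<le> CARD('d)" and p0: "0 < p"
      and liminf_pos: "0 < liminf (\<lambda>j. ereal (real j * ?P j))"
    obtain c where "0 < ereal c" and c_less: "ereal c < liminf (\<lambda>j. ereal (real j * ?P j))"
      using ereal_dense2[OF liminf_pos] by (elim exE conjE)
    then have c: "0 < c" by simp
    obtain J where J: "\<And>k. k \<ge> J \<Longrightarrow> p * c / real k \<le> cover_prob k"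
      using tail_lower[OF c_less] by auto
    \<comment> \<open>Twice the exponent condition for \<theta> = 1/2 and
      \<open>e = CARD('d)\<close>.\<close>
    obtain w where w: "2 * (real CARD('d) + 1) < real w * (p * c)"
      using ex_less_of_nat_mult[of "p * c"] c p0 by auto
    have "AE \<omega> in M. ?edc \<omega>"
      using w J d c p0 card_sphere_sites_le
      by (intro AE_eventually_doubly_covered[where t = "max (max J 1) w" and c = "p * c" and w = w
          and e = "CARD('d)" and \<theta> = "1 / 2"]) auto
    then show "\<P>(\<omega> in M. ?edc \<omega>) = 1" by (rule prob_1)
  next
    assume lim: "(\<lambda>j. real j * ?P j) \<longlonglongrightarrow> 0" and "\<not> (p = 1 \<and> (AE \<omega> in N. rho \<omega> \<ge> 1))"
    then have q1: "cover_prob 1 < 1" by (intro cover_prob_1)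
    \<comment> \<open>\<open>W\<close> stands for the number of parallel lines; the limit 0 absorbs
      any such constant.\<close>
    have "eventually (\<lambda>k. W * cover_prob k * real k \<le> 1) sequentially" for W
    proof -
      have "(\<lambda>k. (W * p) * (real k * ?P k)) \<longlonglongrightarrow> 0"
        using lim by (rule tendsto_mult_right_zero)
      then have "eventually (\<lambda>k. (W * p) * (real k * ?P k) < 1) sequentially"
        by (rule order_tendstoD) simp
      then show ?thesis
        by eventually_elim (simp add: cover_prob_def mult_ac)
    qed
    then have "AE \<omega> in M. \<not> ?edc \<omega>"
      by (intro AE_not_eventually_doubly_covered[of undefined] q1)
    then show "\<P>(\<omega> in M. ?edc \<omega>) = 0" by (rule prob_0)
  qed
qed

end
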